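(* Let $\mathbf{X}=(X_1,\ldots,X_n)$ be a random vector with distribution $\mathbf{F}$ and $Y$ a random variable with distribution $G$, where $G(0-)=0$ and $G(0)<1$. Assume that the components of $\mathbf{X}$ are identically distributed with common distribution $F$. Let $\mathbf{H}$ denote the distribution of $Y\mathbf{X}$, with tail $\overline{\mathbf{H}}(\mathbf{t},x)=\mathbf{P}[YX_1>t_1x,\ldots,YX_n>t_nx]$. Suppose that $\mathbf{X}$ and $Y$ are independent and that there exists a function $a:[0,\infty)\to[0,\infty)$ such that, as $x\to\infty$, (1) $a(x)\to\infty$; (2) $a(x)=o(x)$; (3) $\overline{G}[a(x)]=o[\overline{\mathbf{H}}(\mathbf{t},x)]$ for any $\mathbf{t}\in(0,\infty]^n\setminus\{(\infty,\ldots,\infty)\}$. If $\mathbf{F}\in\mathcal{P_D}_n$, then $\mathbf{H}\in\mathcal{P_D}_n$.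
   Context: For a univariate distribution $F$ write $\overline{F}:=1-F$; throughout $\overline{F}(x)>0$ for all $x\ge0$. $F\in\mathcal{P_D}$ (positively decreasing) if for all (equivalently, for some) $v>1$, $\limsup_{x\to\infty}\overline{F}(vx)/\overline{F}(x)<1$. For a random vector $\mathbf{X}$ with distribution $\mathbf{F}$, the tail is $\overline{\mathbf{F}}(\mathbf{t},x)=\mathbf{P}[X_1>t_1x,\ldots,X_n>t_nx]$ for $\mathbf{t}\in(0,\infty]^n\setminus\{(\infty,\ldots,\infty)\}$; if $t_i=\infty$ the dimension is reduced, i.e. the $i$-th component is dropped. $\mathbf{v}\,\mathbf{t}=(v_1t_1,\ldots,v_nt_n)$. $\mathbf{F}\in\mathcal{P_D}_n$ (multivariate positively decreasing) if there is a univariate $F\in\mathcal{P_D}$ (called a strong kernel) with $\overline{F}_i(x)\sim c_i\overline{F}(x)$ as $x\to\infty$, $c_i\in(0,\infty)$, for every marginal $F_i$, $i=1,\ldots,n$, and $\limsup_{x\to\infty}\overline{\mathbf{F}}(\mathbf{v}\,\mathbf{t},x)/\overline{\mathbf{F}}(\mathbf{t},x)<1$ for any (equivalently, for some) $\mathbf{v}=(v_1,\ldots,v_n)$ with all $v_i>1$ and for all $\mathbf{t}\in(0,\infty]^n\setminus\{(\infty,\ldots,\infty)\}$. (Writing this quotient presupposes that the joint tail is positive.) *)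

theory Defs
  imports "HOL-Probability.Probability" "HOL-Library.Landau_Symbols"
begin

text \<open>
  Univariate distributions are Borel probability measures on the reals, and distributions
  of \<open>n\<close>-dimensional random vectors are Borel probability measures on \<open>real ^ 'n\<close>, with
  \<open>n = CARD('n)\<close> arbitrary.
\<close>

definition tail :: "real measure \<Rightarrow> real \<Rightarrow> real" where
  "tail F x = 1 - cdf F x"

definition positively_decreasing :: "real measure \<Rightarrow> bool" where
  "positively_decreasing F \<longleftrightarrow>
     real_distribution F \<and>
     (\<forall>x\<ge>0. tail F x > 0) \<and>
     (\<forall>v>1. Limsup at_top (\<lambda>x. ereal (tail F (v * x) / tail F x)) < 1)"

text \<open>The index set \<open>(0,\<infinity>]\<^sup>n\<close> without the point \<open>(\<infinity>,\<dots>,\<infinity>)\<close>.\<close>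

definition scalings :: "(ereal ^ 'n) set" where
  "scalings = {t. (\<forall>i. 0 < t $ i) \<and> (\<exists>i. t $ i \<noteq> \<infinity>)}"

definition scale :: "real ^ 'n \<Rightarrow> ereal ^ 'n \<Rightarrow> ereal ^ 'n" where
  "scale v t = (\<chi> i. ereal (v $ i) * t $ i)"

text \<open>
  Components with \<open>t $ i = \<infinity>\<close> are dropped: they put no constraint on \<open>z\<close>. Hence
  \<^const>\<open>real_of_ereal\<close> is only ever used at finite values.
\<close>

definition joint_tail :: "(real ^ 'n) measure \<Rightarrow> ereal ^ 'n \<Rightarrow> real \<Rightarrow> real" where
  "joint_tail D t x =
     measure D {z. \<forall>i. t $ i \<noteq> \<infinity> \<longrightarrow> z $ i > real_of_ereal (t $ i) * x}"

definition marginal :: "(real ^ 'n) measure \<Rightarrow> 'n \<Rightarrow> real measure" where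
  "marginal D i = distr D borel (\<lambda>z. z $ i)"

definition strong_kernel :: "(real ^ 'n) measure \<Rightarrow> real measure \<Rightarrow> bool" where
  "strong_kernel D F \<longleftrightarrow>
     positively_decreasing F \<and>
     (\<forall>i. \<exists>c>0. tail (marginal D i) \<sim>[at_top] (\<lambda>x. c * tail F x))"

text \<open>
  Positivity of the joint tails is an explicit requirement, because the quotients below
  presuppose it and division by zero would yield the value zero.
\<close>

definition mv_positively_decreasing :: "(real ^ 'n) measure \<Rightarrow> bool" where
  "mv_positively_decreasing D \<longleftrightarrow>
     prob_space D \<and> sets D = sets borel \<and>
     (\<exists>F. strong_kernel D F) \<and>
     (\<forall>t\<in>scalings. \<forall>x\<ge>0. joint_tail D t x > 0) \<and>
     (\<forall>v. (\<forall>i. v $ i > 1) \<longrightarrow>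
       (\<forall>t\<in>scalings.
          Limsup at_top (\<lambda>x. ereal (joint_tail D (scale v t) x / joint_tail D t x)) < 1))"

text \<open>
  The library's \<open>indep_var\<close> forces both random variables to have values in the same type;
  this is its characterisation \<open>indep_var_eq\<close> for two Borel random variables whose
  value types may differ.
\<close>

definition indep_rv ::
    "'a measure \<Rightarrow> ('a \<Rightarrow> 'b::topological_space) \<Rightarrow> ('a \<Rightarrow> 'c::topological_space) \<Rightarrow> bool" where
  "indep_rv M X Y \<longleftrightarrow>
     X \<in> borel_measurable M \<and> Y \<in> borel_measurable M \<and>
     prob_space.indep_set M
       (sigma_sets (space M) {X -` A \<inter> space M | A. A \<in> sets borel})
       (sigma_sets (space M) {Y -` A \<inter> space M | A. A \<in> sets borel})"

end

theory Submission
  imports Defs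
begin

text \<open>
  Conditioning on \<open>Y\<close> writes the joint tail of \<open>Y X\<close> as a mixture of joint tails of \<open>X\<close>:
  for \<open>x \<ge> 0\<close>,
  \<open>P[Y X\<^sub>i > t\<^sub>i x for all i] = \<integral> P[X\<^sub>i > t\<^sub>i x / y for all i] G(dy)\<close> over \<open>y > 0\<close>
  (\<open>joint_tail_mixture\<close>), because \<open>Y \<ge> 0\<close> almost surely and \<open>y = 0\<close> contributes nothing.
  Positivity of the joint tails of \<open>Y X\<close> is read off from this formula.

  For the upper limit, fix \<open>v\<close> and \<open>t\<close>. Beyond some \<open>u0\<close> the joint tail of \<open>X\<close> at \<open>v t\<close> is at
  most \<open>\<delta>\<close> times the one at \<open>t\<close>, with \<open>\<delta> < 1\<close>. Since \<open>a(x) = o(x)\<close>, the argument \<open>x / y\<close>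
  is at least \<open>u0\<close> for all \<open>0 < y \<le> a(x)\<close> once \<open>x\<close> is large, so this part of the mixture shrinks by
  the factor \<open>\<delta>\<close>; the part \<open>y > a(x)\<close> has mass at most the tail of \<open>G\<close> at \<open>a(x)\<close>
  (\<open>joint_tail_product_bound\<close>). That mass is negligible against the joint tail of \<open>Y X\<close>, hence
  the upper limit of the quotient is still below one (\<open>Limsup_joint_tail_product_less_1\<close>).

  The strong kernel of \<open>Y X\<close> can be any of its marginals: a marginal tail is a joint tail with
  all but one component dropped, so the marginals inherit positive decrease from the
  multivariate estimate; and the mixture formula shows that all marginal tails agree on
  \<open>[0,\<infinity>)\<close> because those of \<open>X\<close> do.
\<close>

section \<open>Tail sets and scalings\<close>

definition corner :: "ereal ^ 'n \<Rightarrow> real \<Rightarrow> (real ^ 'n) set" where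
  "corner t x = {z. \<forall>i. t $ i \<noteq> \<infinity> \<longrightarrow> z $ i > real_of_ereal (t $ i) * x}"

lemma joint_tail_corner: "joint_tail D t x = measure D (corner t x)"
  by (simp add: joint_tail_def corner_def)

lemma corner_sets: "corner t x \<in> sets (borel :: (real ^ 'n) measure)"
proof -
  have "corner t x = (\<Inter>i\<in>{i. t $ i \<noteq> \<infinity>}. {z. z $ i > real_of_ereal (t $ i) * x})"
    by (auto simp: corner_def)
  moreover have "open \<dots>"
    by (intro open_INT ballI open_halfspace_component_gt_cart) simp
  ultimately show ?thesis
    by simp
qed

lemma scaled_corner_sets:
  fixes t :: "ereal ^ 'n"
  shows "{(z, y). y *\<^sub>R z \<in> corner t x} \<in> sets (borel \<Otimes>\<^sub>M borel)"
proof -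
  have "(\<lambda>(z, y). y *\<^sub>R z) \<in> borel_measurable (borel \<Otimes>\<^sub>M borel :: ((real ^ 'n) \<times> real) measure)"
    by measurable
  from measurable_sets[OF this corner_sets[of t x]] show ?thesis
    by (simp add: vimage_def space_pair_measure case_prod_beta')
qed

lemma scaled_in_corner_iff:
  assumes "y > 0"
  shows "y *\<^sub>R z \<in> corner t x \<longleftrightarrow> z \<in> corner t (x / y)"
  using assms by (simp add: corner_def field_simps)

text \<open>
  At least one component of \<open>t\<close> is a positive real and really constrains the point. This is
  why the event \<open>Y = 0\<close> does not contribute to the joint tail of \<open>Y X\<close>.
\<close>

lemma zero_notin_corner:
  assumes "t \<in> scalings" and "x \<ge> 0"
  shows "0 \<notin> corner t x"
proof -
  obtain i where "t $ i \<noteq> \<infinity>" and "0 < t $ i"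
    using assms(1) by (auto simp: scalings_def)
  then have "real_of_ereal (t $ i) * x \<ge> 0"
    using assms(2) by (simp add: real_of_ereal_pos)
  then show ?thesis
    using \<open>t $ i \<noteq> \<infinity>\<close> by (auto simp: corner_def not_less)
qed

lemma scale_one: "scale (\<chi> j. 1) t = t"
  by (simp add: scale_def vec_eq_iff flip: one_ereal_def)

lemma scale_in_scalings:
  assumes "t \<in> scalings" and "\<forall>i. v $ i > 0"
  shows "scale v t \<in> scalings"
proof -
  have "0 < scale v t $ i" for i
    using assms by (simp add: scale_def scalings_def ereal_zero_less_0_iff)
  moreover obtain i where "t $ i \<noteq> \<infinity>"
    using assms(1) by (auto simp: scalings_def)
  then have "scale v t $ i \<noteq> \<infinity>"
    using assms by (cases "t $ i") (auto simp: scale_def scalings_def)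
  ultimately show ?thesis
    by (auto simp: scalings_def)
qed

section \<open>The joint tail of a product as a mixture\<close>

lemma indep_rv_pair_measure:
  fixes X :: "'a \<Rightarrow> 'b::second_countable_topology"
    and Y :: "'a \<Rightarrow> 'c::second_countable_topology"
  assumes "prob_space M" and "indep_rv M X Y"
  shows "distr M borel X \<Otimes>\<^sub>M distr M borel Y
    = distr M (borel \<Otimes>\<^sub>M borel) (\<lambda>\<omega>. (X \<omega>, Y \<omega>))"
proof -
  interpret prob_space M by fact
  have X[measurable]: "X \<in> borel_measurable M" and Y[measurable]: "Y \<in> borel_measurable M"
    using assms(2) by (auto simp: indep_rv_def)
  interpret PX: prob_space "distr M borel X" by (rule prob_space_distr) fact
  interpret PY: prob_space "distr M borel Y" by (rule prob_space_distr) fact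
  show ?thesis
  proof (rule pair_measure_eqI)
    fix A B
    assume "A \<in> sets (distr M borel X)" and "B \<in> sets (distr M borel Y)"
    then have A[measurable]: "A \<in> sets borel" and B[measurable]: "B \<in> sets borel"
      by simp_all
    have "indep_set (sigma_sets (space M) {X -` A \<inter> space M | A. A \<in> sets borel})
       (sigma_sets (space M) {Y -` A \<inter> space M | A. A \<in> sets borel})"
      using assms(2) by (simp add: indep_rv_def)
    then have "prob ((X -` A \<inter> space M) \<inter> (Y -` B \<inter> space M))
      = prob (X -` A \<inter> space M) * prob (Y -` B \<inter> space M)"
      by (rule indep_setD) (auto intro!: sigma_sets.Basic)
    moreover have "(\<lambda>\<omega>. (X \<omega>, Y \<omega>)) -` (A \<times> B) \<inter> space M
      = (X -` A \<inter> space M) \<inter> (Y -` B \<inter> space M)"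
      by auto
    ultimately show "emeasure (distr M borel X) A * emeasure (distr M borel Y) B
      = emeasure (distr M (borel \<Otimes>\<^sub>M borel) (\<lambda>\<omega>. (X \<omega>, Y \<omega>))) (A \<times> B)"
      by (simp add: emeasure_distr emeasure_eq_measure ennreal_mult)
  qed (auto intro: PX.sigma_finite_measure_axioms PY.sigma_finite_measure_axioms
      cong: sets_pair_measure_cong)
qed

lemma emeasure_scaled_corner:
  fixes X :: "'a \<Rightarrow> real ^ 'n" and Y :: "'a \<Rightarrow> real"
  assumes "prob_space M" and indep: "indep_rv M X Y"
  shows "emeasure (distr M borel (\<lambda>\<omega>. Y \<omega> *\<^sub>R X \<omega>)) (corner t x)
      = (\<integral>\<^sup>+y. emeasure (distr M borel X) {z. y *\<^sub>R z \<in> corner t x} \<partial>distr M borel Y)"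
    and "(\<lambda>y. emeasure (distr M borel X) {z. y *\<^sub>R z \<in> corner t x}) \<in> borel_measurable borel"
proof -
  interpret prob_space M by fact
  have [measurable]: "X \<in> borel_measurable M" "Y \<in> borel_measurable M"
    using indep by (auto simp: indep_rv_def)
  interpret PX: prob_space "distr M borel X" by (rule prob_space_distr) fact
  interpret PY: prob_space "distr M borel Y" by (rule prob_space_distr) fact
  interpret pair_sigma_finite "distr M borel X" "distr M borel Y" ..
  let ?N = "{(z, y). y *\<^sub>R z \<in> corner t x}"
  note [measurable] = scaled_corner_sets[of t x] corner_sets[of t x]
  have N: "?N \<in> sets (distr M borel X \<Otimes>\<^sub>M distr M borel Y)"
    using scaled_corner_sets[of t x] by (simp cong: sets_pair_measure_cong)
  have "emeasure (distr M borel (\<lambda>\<omega>. Y \<omega> *\<^sub>R X \<omega>)) (corner t x)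
      = emeasure (distr M (borel \<Otimes>\<^sub>M borel) (\<lambda>\<omega>. (X \<omega>, Y \<omega>))) ?N"
  proof -
    have "(\<lambda>\<omega>. (X \<omega>, Y \<omega>)) -` ?N = (\<lambda>\<omega>. Y \<omega> *\<^sub>R X \<omega>) -` corner t x"
      by auto
    then show ?thesis
      by (subst (1 2) emeasure_distr) auto
  qed
  also have "\<dots> = emeasure (distr M borel X \<Otimes>\<^sub>M distr M borel Y) ?N"
    by (simp add: indep_rv_pair_measure[OF assms])
  also have "\<dots> = (\<integral>\<^sup>+y. emeasure (distr M borel X) ((\<lambda>z. (z, y)) -` ?N) \<partial>distr M borel Y)"
    by (rule emeasure_pair_measure_alt2) (rule N)
  finally show "emeasure (distr M borel (\<lambda>\<omega>. Y \<omega> *\<^sub>R X \<omega>)) (corner t x)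
      = (\<integral>\<^sup>+y. emeasure (distr M borel X) {z. y *\<^sub>R z \<in> corner t x} \<partial>distr M borel Y)"
    by (simp add: vimage_def)
  show "(\<lambda>y. emeasure (distr M borel X) {z. y *\<^sub>R z \<in> corner t x}) \<in> borel_measurable borel"
    using measurable_emeasure_Pair2[OF N] by (simp add: vimage_def)
qed

text \<open>
  For \<open>y > 0\<close> the slice \<open>{z. y z \<in> corner t x}\<close> of the previous formula is \<open>corner t (x / y)\<close>, whereas
  for \<open>y = 0\<close> it is empty. The restriction to \<open>y > 0\<close> has to be part of the integrand, because
  at \<open>y = 0\<close> the quotient \<open>x / y\<close> has the default value zero, and the joint tail of \<open>X\<close> at zero
  may well be positive.
\<close>

lemma joint_tail_mixture:
  fixes X :: "'a \<Rightarrow> real ^ 'n" and Y :: "'a \<Rightarrow> real"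
  assumes M: "prob_space M" and indep: "indep_rv M X Y"
    and nonneg: "AE y in distr M borel Y. y \<ge> 0"
    and t: "t \<in> scalings" and x: "x \<ge> 0"
  defines "k \<equiv> \<lambda>y. indicator {0<..} y * ennreal (joint_tail (distr M borel X) t (x / y))"
  shows "ennreal (joint_tail (distr M borel (\<lambda>\<omega>. Y \<omega> *\<^sub>R X \<omega>)) t x)
      = (\<integral>\<^sup>+y. k y \<partial>distr M borel Y)"
    and "k \<in> borel_measurable borel"
proof -
  interpret prob_space M by fact
  have [measurable]: "X \<in> borel_measurable M" "Y \<in> borel_measurable M"
    using indep by (auto simp: indep_rv_def)
  interpret PX: prob_space "distr M borel X" by (rule prob_space_distr) fact
  interpret PH: prob_space "distr M borel (\<lambda>\<omega>. Y \<omega> *\<^sub>R X \<omega>)"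
    by (rule prob_space_distr) measurable
  define e where "e y = emeasure (distr M borel X) {z. y *\<^sub>R z \<in> corner t x}" for y :: real
  have e_meas[measurable]: "e \<in> borel_measurable borel"
    unfolding e_def by (rule emeasure_scaled_corner(2)[OF M indep])
  have k_e: "k y = indicator {0<..} y * e y" for y
    by (auto simp: k_def e_def joint_tail_corner PX.emeasure_eq_measure scaled_in_corner_iff
        split: split_indicator)
  have "k = (\<lambda>y. indicator {0<..} y * e y)"
    by (simp add: fun_eq_iff k_e)
  then show "k \<in> borel_measurable borel"
    by simp
  have "ennreal (joint_tail (distr M borel (\<lambda>\<omega>. Y \<omega> *\<^sub>R X \<omega>)) t x)
      = emeasure (distr M borel (\<lambda>\<omega>. Y \<omega> *\<^sub>R X \<omega>)) (corner t x)"
    by (simp add: joint_tail_corner PH.emeasure_eq_measure)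
  also have "\<dots> = (\<integral>\<^sup>+y. e y \<partial>distr M borel Y)"
    unfolding e_def by (rule emeasure_scaled_corner(1)[OF M indep])
  also have "\<dots> = (\<integral>\<^sup>+y. k y \<partial>distr M borel Y)"
  proof (rule nn_integral_cong_AE)
    have "e 0 = 0"
      using zero_notin_corner[OF t x] by (simp add: e_def)
    show "AE y in distr M borel Y. e y = k y"
      using nonneg
    proof eventually_elim
      case (elim y)
      then show ?case
        using \<open>e 0 = 0\<close> by (cases "y = 0") (auto simp: k_e)
    qed
  qed
  finally show "ennreal (joint_tail (distr M borel (\<lambda>\<omega>. Y \<omega> *\<^sub>R X \<omega>)) t x)
      = (\<integral>\<^sup>+y. k y \<partial>distr M borel Y)" .
qed

text \<open>
  If the mixture integral vanished, then so would its integrand for almost every \<open>y\<close>. But the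
  integrand is positive for all \<open>y > 0\<close>, and \<open>Y > 0\<close> has positive probability.
\<close>

lemma joint_tail_product_pos:
  fixes X :: "'a \<Rightarrow> real ^ 'n" and Y :: "'a \<Rightarrow> real"
  assumes M: "prob_space M" and indep: "indep_rv M X Y"
    and nonneg: "AE y in distr M borel Y. y \<ge> 0"
    and Y_pos: "tail (distr M borel Y) 0 > 0"
    and t: "t \<in> scalings" and x: "x \<ge> 0"
    and X_pos: "\<And>u. u \<ge> 0 \<Longrightarrow> joint_tail (distr M borel X) t u > 0"
  shows "joint_tail (distr M borel (\<lambda>\<omega>. Y \<omega> *\<^sub>R X \<omega>)) t x > 0"
proof (rule ccontr)
  interpret prob_space M by fact
  have [measurable]: "Y \<in> borel_measurable M"
    using indep by (auto simp: indep_rv_def)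
  interpret G: prob_space "distr M borel Y" by (rule prob_space_distr) fact
  assume "\<not> ?thesis"
  then have "(\<integral>\<^sup>+y. indicator {0<..} y * ennreal (joint_tail (distr M borel X) t (x / y))
      \<partial>distr M borel Y) = 0"
    by (simp add: joint_tail_mixture(1)[OF M indep nonneg t x, symmetric] ennreal_neg)
  then have "AE y in distr M borel Y.
      indicator {0<..} y * ennreal (joint_tail (distr M borel X) t (x / y)) = 0"
    using joint_tail_mixture(2)[OF M indep nonneg t x]
    by (subst (asm) nn_integral_0_iff_AE) auto
  then have "AE y in distr M borel Y. y \<in> {..0}"
  proof eventually_elim
    case (elim y)
    then show ?case
      using X_pos[of "x / y"] x by (cases "y > 0") (auto simp: ennreal_eq_0_iff)
  qed
  then have "G.prob {..0} = 1"
    by (subst G.prob_eq_1) auto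
  then show False
    using Y_pos by (simp add: tail_def cdf_def)
qed

section \<open>The upper limit of the joint tail quotient\<close>

text \<open>
  Truncation of the mixture at the level \<open>b\<close>: below \<open>b\<close> the assumed inequality is integrated,
  above \<open>b\<close> the integrand is bounded by one.
\<close>

lemma joint_tail_product_bound:
  fixes X :: "'a \<Rightarrow> real ^ 'n" and Y :: "'a \<Rightarrow> real"
  assumes M: "prob_space M" and indep: "indep_rv M X Y"
    and nonneg: "AE y in distr M borel Y. y \<ge> 0"
    and s: "s \<in> scalings" and t: "t \<in> scalings" and x: "x \<ge> 0" and \<delta>: "\<delta> \<ge> 0"
    and bound: "\<And>y. 0 < y \<Longrightarrow> y \<le> b \<Longrightarrow>
      joint_tail (distr M borel X) s (x / y) \<le> \<delta> * joint_tail (distr M borel X) t (x / y)"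
  shows "joint_tail (distr M borel (\<lambda>\<omega>. Y \<omega> *\<^sub>R X \<omega>)) s x
      \<le> \<delta> * joint_tail (distr M borel (\<lambda>\<omega>. Y \<omega> *\<^sub>R X \<omega>)) t x + tail (distr M borel Y) b"
proof -
  interpret prob_space M by fact
  have [measurable]: "X \<in> borel_measurable M" "Y \<in> borel_measurable M"
    using indep by (auto simp: indep_rv_def)
  interpret PX: prob_space "distr M borel X" by (rule prob_space_distr) fact
  interpret G: prob_space "distr M borel Y" by (rule prob_space_distr) fact
  let ?J = "joint_tail (distr M borel X)"
  let ?H = "joint_tail (distr M borel (\<lambda>\<omega>. Y \<omega> *\<^sub>R X \<omega>))"
  define k where "k r y = indicator {0<..} y * ennreal (?J r (x / y))" for r and y :: real
  have [measurable]: "k t \<in> borel_measurable borel"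
    unfolding k_def by (rule joint_tail_mixture(2)[OF M indep nonneg t x])
  have tail_G: "G.prob {b<..} = tail (distr M borel Y) b"
  proof -
    have "UNIV - {..b} = {b<..}" by auto
    then show ?thesis
      using G.prob_compl[of "{..b}"] by (simp add: tail_def cdf_def)
  qed
  have J_nonneg: "?H t x \<ge> 0" and G_nonneg: "tail (distr M borel Y) b \<ge> 0"
    by (simp_all add: joint_tail_corner tail_G[symmetric])
  have "k s y \<le> ennreal \<delta> * k t y + indicator {b<..} y" for y
  proof (cases "0 < y \<and> y \<le> b")
    case True
    then have "k s y \<le> ennreal (\<delta> * ?J t (x / y))"
      using bound[of y] by (simp add: k_def ennreal_leI)
    also have "\<dots> = ennreal \<delta> * k t y"
      using True \<delta> by (simp add: k_def ennreal_mult' joint_tail_corner)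
    finally show ?thesis
      using True by simp
  next
    case False
    have "?J s (x / y) \<le> 1"
      by (simp add: joint_tail_corner PX.prob_le_1)
    then have "k s y \<le> indicator {b<..} y"
      using False by (auto simp: k_def split: split_indicator)
    then show ?thesis
      by (metis add.commute add_increasing2 zero_le)
  qed
  then have "(\<integral>\<^sup>+y. k s y \<partial>distr M borel Y)
      \<le> (\<integral>\<^sup>+y. ennreal \<delta> * k t y + indicator {b<..} y \<partial>distr M borel Y)"
    by (intro nn_integral_mono)
  also have "\<dots> = ennreal \<delta> * (\<integral>\<^sup>+y. k t y \<partial>distr M borel Y) + emeasure (distr M borel Y) {b<..}"
    by (simp add: nn_integral_add nn_integral_cmult)
  finally have "ennreal (?H s x) \<le> ennreal \<delta> * ennreal (?H t x) + ennreal (G.prob {b<..})"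
    unfolding k_def joint_tail_mixture(1)[OF M indep nonneg s x]
      joint_tail_mixture(1)[OF M indep nonneg t x] G.emeasure_eq_measure .
  then have "ennreal (?H s x) \<le> ennreal (\<delta> * ?H t x + tail (distr M borel Y) b)"
    using \<delta> J_nonneg G_nonneg by (simp add: tail_G ennreal_mult'' ennreal_plus)
  moreover have "0 \<le> \<delta> * ?H t x + tail (distr M borel Y) b"
    using \<delta> J_nonneg G_nonneg by simp
  ultimately show ?thesis
    using ennreal_le_iff by blast
qed

text \<open>
  The truncation is applied at the level \<open>a x\<close>. It is low enough, being \<open>o(x)\<close>, for the quotient
  of the tails of \<open>X\<close> to be evaluated only far out, and high enough for the mass of \<open>Y\<close> beyond it
  to be negligible.
\<close>

lemma Limsup_joint_tail_product_less_1:
  fixes X :: "'a \<Rightarrow> real ^ 'n" and Y :: "'a \<Rightarrow> real" and a :: "real \<Rightarrow> real"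
  assumes M: "prob_space M" and indep: "indep_rv M X Y"
    and nonneg: "AE y in distr M borel Y. y \<ge> 0"
    and s: "s \<in> scalings" and t: "t \<in> scalings"
    and X_pos: "\<And>u. u \<ge> 0 \<Longrightarrow> joint_tail (distr M borel X) t u > 0"
    and H_pos: "\<And>u. u \<ge> 0 \<Longrightarrow> joint_tail (distr M borel (\<lambda>\<omega>. Y \<omega> *\<^sub>R X \<omega>)) t u > 0"
    and a: "a \<in> o[at_top](\<lambda>x. x)"
    and G: "(\<lambda>x. tail (distr M borel Y) (a x))
      \<in> o[at_top](\<lambda>x. joint_tail (distr M borel (\<lambda>\<omega>. Y \<omega> *\<^sub>R X \<omega>)) t x)"
    and X_Limsup: "Limsup at_top (\<lambda>x. ereal (joint_tail (distr M borel X) s x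
      / joint_tail (distr M borel X) t x)) < 1"
  shows "Limsup at_top (\<lambda>x. ereal (joint_tail (distr M borel (\<lambda>\<omega>. Y \<omega> *\<^sub>R X \<omega>)) s x
      / joint_tail (distr M borel (\<lambda>\<omega>. Y \<omega> *\<^sub>R X \<omega>)) t x)) < 1"
proof -
  let ?J = "joint_tail (distr M borel X)"
  let ?H = "joint_tail (distr M borel (\<lambda>\<omega>. Y \<omega> *\<^sub>R X \<omega>))"
  obtain \<delta> where \<delta>: "Limsup at_top (\<lambda>x. ereal (?J s x / ?J t x)) < ereal \<delta>" "\<delta> < 1"
    using ereal_dense2[OF X_Limsup] by auto
  have "\<forall>\<^sub>F x in at_top. ?J s x / ?J t x < \<delta>"
    using Limsup_lessD[OF \<delta>(1)] by simp
  then obtain u1 where u1: "\<And>u. u \<ge> u1 \<Longrightarrow> ?J s u / ?J t u < \<delta>"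
    by (auto simp: eventually_at_top_linorder)
  \<comment> \<open>The threshold must be positive, since \<open>1 / u0\<close> serves as the constant in \<open>a(x) = o(x)\<close>.\<close>
  define u0 where "u0 = max u1 1"
  have "u0 > 0"
    by (simp add: u0_def)
  have u0: "?J s u \<le> \<delta> * ?J t u" if "u \<ge> u0" for u
    using u1[of u] X_pos[of u] that by (auto simp: u0_def field_simps)
  have "0 \<le> ?J s u0 / ?J t u0"
    by (simp add: joint_tail_corner)
  also have "\<dots> < \<delta>"
    by (rule u1) (simp add: u0_def)
  finally have "\<delta> > 0" .
  \<comment> \<open>Half of the gap between \<open>\<delta>\<close> and one absorbs the contribution of large \<open>Y\<close>.\<close>
  define \<epsilon> where "\<epsilon> = (1 - \<delta>) / 2"
  have "\<epsilon> > 0" "\<delta> + \<epsilon> < 1"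
    using \<delta>(2) by (auto simp: \<epsilon>_def field_simps)
  have "\<forall>\<^sub>F x in at_top. norm (a x) \<le> (1 / u0) * norm x"
    using landau_o.smallD[OF a, of "1 / u0"] \<open>u0 > 0\<close> by simp
  moreover have "\<forall>\<^sub>F x in at_top. norm (tail (distr M borel Y) (a x)) \<le> \<epsilon> * norm (?H t x)"
    using landau_o.smallD[OF G \<open>\<epsilon> > 0\<close>] .
  moreover have "\<forall>\<^sub>F x in at_top. x > (0::real)"
    by (rule eventually_gt_at_top)
  ultimately have "\<forall>\<^sub>F x in at_top. ereal (?H s x / ?H t x) \<le> ereal (\<delta> + \<epsilon>)"
  proof eventually_elim
    case (elim x)
    have "?J s (x / y) \<le> \<delta> * ?J t (x / y)" if "0 < y" "y \<le> a x" for y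
    proof (rule u0)
      have "y \<le> x / u0"
        using elim that by simp
      then show "u0 \<le> x / y"
        using that \<open>u0 > 0\<close> by (simp add: field_simps)
    qed
    then have "?H s x \<le> \<delta> * ?H t x + tail (distr M borel Y) (a x)"
      using elim \<open>\<delta> > 0\<close>
      by (intro joint_tail_product_bound[OF M indep nonneg s t]) auto
    also have "\<dots> \<le> (\<delta> + \<epsilon>) * ?H t x"
      using elim H_pos[of x] by (simp add: algebra_simps)
    finally show ?case
      using H_pos[of x] elim by (simp add: field_simps)
  qed
  then have "Limsup at_top (\<lambda>x. ereal (?H s x / ?H t x)) \<le> ereal (\<delta> + \<epsilon>)"
    by (rule Limsup_bounded)
  also have "\<dots> < 1"
    using \<open>\<delta> + \<epsilon> < 1\<close> by simp
  finally show ?thesis .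
qed

section \<open>Marginals as joint tails\<close>

definition axis_scaling :: "'n \<Rightarrow> ereal ^ 'n" where
  "axis_scaling i = (\<chi> j. if j = i then 1 else \<infinity>)"

lemma axis_scaling_in_scalings: "axis_scaling i \<in> scalings"
  by (auto simp: scalings_def axis_scaling_def intro!: exI[of _ i])

text \<open>
  Univariate quotients compare the arguments \<open>v x\<close> and \<open>x\<close>, multivariate ones compare the scalings
  \<open>v t\<close> and \<open>t\<close>. On an axis the two viewpoints coincide, because multiplication by \<open>v\<close> leaves
  the infinite components, hence the dropped constraints, as they are.
\<close>

lemma tail_marginal:
  fixes D :: "(real ^ 'n) measure"
  assumes "prob_space D" and D: "sets D = sets borel" and v: "v > 0"
  shows "tail (marginal D i) (v * x) = joint_tail D (scale (\<chi> j. v) (axis_scaling i)) x"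
proof -
  interpret prob_space D by fact
  have m: "(\<lambda>z. z $ i) \<in> borel_measurable D"
    using D by (simp cong: measurable_cong_sets)
  have sp: "space D = UNIV"
    using sets_eq_imp_space_eq[OF D] by simp
  have "tail (marginal D i) (v * x) = 1 - prob {z. z $ i \<le> v * x}"
    using m by (simp add: tail_def cdf_def marginal_def measure_distr sp vimage_def)
  also have "\<dots> = prob (space D - {z. z $ i \<le> v * x})"
    by (rule prob_compl[symmetric]) (simp add: D)
  also have "space D - {z. z $ i \<le> v * x}
      = corner (scale (\<chi> j. v) (axis_scaling i)) x"
    using v by (auto simp: sp corner_def scale_def axis_scaling_def)
  finally show ?thesis
    by (simp add: joint_tail_corner)
qed

corollary tail_marginal_axis:
  fixes D :: "(real ^ 'n) measure"
  assumes "prob_space D" and "sets D = sets borel"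
  shows "tail (marginal D i) x = joint_tail D (axis_scaling i) x"
  using tail_marginal[OF assms, of 1 i x] by (simp add: scale_one)

lemma positively_decreasing_marginal:
  fixes D :: "(real ^ 'n) measure"
  assumes D: "prob_space D" "sets D = sets borel"
    and pos: "\<And>x. x \<ge> 0 \<Longrightarrow> joint_tail D (axis_scaling i) x > 0"
    and lim: "\<And>v. \<forall>j. v $ j > 1 \<Longrightarrow>
      Limsup at_top (\<lambda>x. ereal (joint_tail D (scale v (axis_scaling i)) x
        / joint_tail D (axis_scaling i) x)) < 1"
  shows "positively_decreasing (marginal D i)"
proof -
  interpret prob_space D by fact
  have m: "(\<lambda>z. z $ i) \<in> borel_measurable D"
    using D(2) by (simp cong: measurable_cong_sets)
  have "real_distribution (marginal D i)"
    unfolding marginal_def using m by (rule real_distribution_distr)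
  moreover have "Limsup at_top
      (\<lambda>x. ereal (tail (marginal D i) (v * x) / tail (marginal D i) x)) < 1" if "v > 1" for v
    using lim[of "\<chi> j. v"] tail_marginal[OF D, of v] that by (simp add: tail_marginal_axis[OF D])
  ultimately show ?thesis
    using pos by (simp add: positively_decreasing_def tail_marginal_axis[OF D])
qed

section \<open>Products with an independent nonnegative factor\<close>

theorem theorem6p1:
  fixes M :: "'a measure"
    and X :: "'a \<Rightarrow> real ^ 'n"
    and Y :: "'a \<Rightarrow> real"
    and F G :: "real measure"
    and FF HH :: "(real ^ 'n) measure"
    and a :: "real \<Rightarrow> real"
  assumes "prob_space M"
    and "X \<in> borel_measurable M"
    and "Y \<in> borel_measurable M"
    and FF_def: "FF = distr M borel X"
    and G_def: "G = distr M borel Y"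
    and HH_def: "HH = distr M borel (\<lambda>\<omega>. Y \<omega> *\<^sub>R X \<omega>)"
    and "(cdf G \<longlongrightarrow> 0) (at_left 0)"
    and "cdf G 0 < 1"
    and "\<forall>i. marginal FF i = F"
    and "indep_rv M X Y"
    and "\<forall>x\<ge>0. a x \<ge> 0"
    and "filterlim a at_top at_top"
    and "a \<in> o[at_top](\<lambda>x. x)"
    and "\<forall>t\<in>scalings. (\<lambda>x. tail G (a x)) \<in> o[at_top](\<lambda>x. joint_tail HH t x)"
    and "mv_positively_decreasing FF"
  shows "mv_positively_decreasing HH"
proof -
  note M = assms(1) and [measurable] = assms(2,3) and indep = \<open>indep_rv M X Y\<close>
  interpret prob_space M by fact
  interpret FF: prob_space FF
    unfolding FF_def by (rule prob_space_distr) measurable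
  interpret HH: prob_space HH
    unfolding HH_def by (rule prob_space_distr) measurable
  interpret G: real_distribution G
    unfolding G_def by (rule real_distribution_distr) measurable
  have sets: "sets FF = sets borel" "sets HH = sets borel"
    by (simp_all add: FF_def HH_def)

  have "G.prob {..<0} = 0"
    using tendsto_unique[OF _ G.cdf_at_left \<open>(cdf G \<longlongrightarrow> 0) (at_left 0)\<close>] by simp
  then have "AE y in G. y \<notin> {..<0}"
    by (subst G.prob_eq_0[symmetric]) (auto simp: G_def)
  then have nonneg: "AE y in distr M borel Y. y \<ge> 0"
    unfolding G_def by eventually_elim simp
  have Y_pos: "tail (distr M borel Y) 0 > 0"
    using \<open>cdf G 0 < 1\<close> by (simp add: tail_def G_def)

  have FF_pos: "joint_tail FF t x > 0" if "t \<in> scalings" "x \<ge> 0" for t x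
    using \<open>mv_positively_decreasing FF\<close> that by (simp add: mv_positively_decreasing_def)
  have HH_pos: "joint_tail HH t x > 0" if "t \<in> scalings" "x \<ge> 0" for t x
    unfolding HH_def using FF_pos that
    by (intro joint_tail_product_pos[OF M indep nonneg Y_pos]) (simp_all add: FF_def)

  have HH_lim: "Limsup at_top (\<lambda>x. ereal (joint_tail HH (scale v t) x / joint_tail HH t x)) < 1"
    if v: "\<forall>i. v $ i > 1" and t: "t \<in> scalings" for v t
    unfolding HH_def
  proof (rule Limsup_joint_tail_product_less_1[OF M indep nonneg _ t _ _ \<open>a \<in> o[at_top](\<lambda>x. x)\<close>])
    have "\<forall>i. v $ i > 0"
      using v by (meson less_trans zero_less_one)
    then show "scale v t \<in> scalings"
      by (rule scale_in_scalings[OF t])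
    show "(\<lambda>x. tail (distr M borel Y) (a x))
        \<in> o[at_top](joint_tail (distr M borel (\<lambda>\<omega>. Y \<omega> *\<^sub>R X \<omega>)) t)"
      using assms(14) t by (simp add: G_def HH_def)
    show "Limsup at_top (\<lambda>x. ereal (joint_tail (distr M borel X) (scale v t) x
        / joint_tail (distr M borel X) t x)) < 1"
      using \<open>mv_positively_decreasing FF\<close> v t by (simp add: mv_positively_decreasing_def FF_def)
  qed (use FF_pos HH_pos t in \<open>simp_all add: FF_def HH_def\<close>)

  have same: "tail (marginal HH i) x = tail (marginal HH j) x" if "x \<ge> 0" for i j x
  proof -
    have "joint_tail FF (axis_scaling i) u = joint_tail FF (axis_scaling j) u" for u
      using tail_marginal_axis[OF FF.prob_space_axioms sets(1)] \<open>\<forall>i. marginal FF i = F\<close> by metis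
    then have "ennreal (joint_tail HH (axis_scaling i) x)
        = ennreal (joint_tail HH (axis_scaling j) x)"
      unfolding HH_def joint_tail_mixture(1)[OF M indep nonneg axis_scaling_in_scalings that]
      by (simp add: FF_def)
    then show ?thesis
      by (simp add: tail_marginal_axis[OF HH.prob_space_axioms sets(2)] joint_tail_corner)
  qed
  obtain i0 :: 'n where True by simp
  have "strong_kernel HH (marginal HH i0)"
    unfolding strong_kernel_def
  proof (intro conjI allI exI[of _ 1])
    show "positively_decreasing (marginal HH i0)"
      by (intro positively_decreasing_marginal HH.prob_space_axioms sets(2)
          HH_pos[OF axis_scaling_in_scalings] HH_lim[OF _ axis_scaling_in_scalings])
    fix i
    have "\<forall>\<^sub>F x in at_top. tail (marginal HH i) x = tail (marginal HH i0) x"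
      using eventually_ge_at_top[of 0] by eventually_elim (rule same)
    then show "tail (marginal HH i) \<sim>[at_top] (\<lambda>x. 1 * tail (marginal HH i0) x)"
      by (simp add: asymp_equiv_refl_ev)
  qed simp
  then show ?thesis
    unfolding mv_positively_decreasing_def
    using HH.prob_space_axioms sets(2) HH_pos HH_lim by blast
qed

end
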